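(* Let $n\ge1$, let $S\subseteq V(G_n)$ be nonempty, and for each integer $r\ge 0$ let $\mathrm{Sh}_S^{(r)}=\{\lambda\in V(G_n): d_S(\lambda)=r\}$. Then every edge of $G_n$ either lies inside a single shell $\mathrm{Sh}_S^{(r)}$ or joins two adjacent shells $\mathrm{Sh}_S^{(r)}$ and $\mathrm{Sh}_S^{(r+1)}$.
   Context: Partition graph: for $n\ge 1$, the vertices of the simple graph $G_n$ are the partitions $\lambda=(\lambda_1\ge\dots\ge\lambda_k>0)$ of $n$. An elementary unit transfer on $\lambda=(\lambda_1,\dots,\lambda_k)$: choose distinct indices $i,j\in\{1,\dots,k\}$, replace $\lambda_i$ by $\lambda_i+1$ and $\lambda_j$ by $\lambda_j-1$, delete the latter if it becomes $0$, and reorder the parts into nonincreasing form; if the resulting partition $\mu$ satisfies $\mu\neq\lambda$, then $\mu$ is obtained from $\lambda$ by an elementary unit transfer. Two partitions $\lambda,\mu$ of $n$ are adjacent in $G_n$ if one of them is obtained from the other by a single elementary unit transfer. The graph $G_n$ is connected. For nonempty $S\subseteq V(G_n)$, $d_S(\lambda)=\min_{\sigma\in S}d_{G_n}(\lambda,\sigma)$, where $d_{G_n}$ is the graph distance. *)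

theory Defs
  imports "Graph_Theory.Graph_Theory"
begin

definition partitions :: "nat \<Rightarrow> nat list set" where
  "partitions n = {p. sorted_wrt (\<ge>) p \<and> 0 \<notin> set p \<and> sum_list p = n}"

text \<open>In a partition no part is zero, so the subtraction below does not truncate and
  \<^term>\<open>removeAll 0\<close> can only delete the part that has just been decreased.\<close>

definition unit_transfer :: "nat list \<Rightarrow> nat list \<Rightarrow> bool" where
  "unit_transfer p q \<longleftrightarrow>
     (\<exists>i<length p. \<exists>j<length p. i \<noteq> j \<and>
        q = rev (sort (removeAll 0 (p[i := p ! i + 1, j := p ! j - 1])))) \<and> q \<noteq> p"

text \<open>As usual in \<^theory>\<open>Graph_Theory.Digraph\<close>, a simple graph is a symmetric loop-free digraph:
  the edge joining \<open>p\<close> and \<open>q\<close> is the pair of arcs \<open>(p, q)\<close>, \<open>(q, p)\<close>.\<close>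

definition partition_graph :: "nat \<Rightarrow> nat list pair_pre_digraph" where
  "partition_graph n =
     \<lparr> pverts = partitions n,
       parcs = {(p, q). p \<in> partitions n \<and> q \<in> partitions n \<and>
                        (unit_transfer p q \<or> unit_transfer q p)} \<rparr>"

lemma finite_partitions: "finite (partitions n)"
proof (rule finite_subset)
  have "length p \<le> sum_list p" if "0 \<notin> set p" for p :: "nat list"
    using that by (induction p) auto
  then show "partitions n \<subseteq> {p. set p \<subseteq> {..n} \<and> length p \<le> n}"
    by (auto simp: partitions_def dest: member_le_sum_list)
  show "finite {p. set p \<subseteq> {..n} \<and> length p \<le> n}"
    by (rule finite_lists_length_le) simp
qed

lemma pair_graph_partition_graph: "pair_graph (partition_graph n)"
proof
  have "parcs (partition_graph n) \<subseteq> partitions n \<times> partitions n"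
    by (auto simp: partition_graph_def)
  then show "finite (parcs (partition_graph n))"
    by (rule finite_subset) (simp add: finite_partitions)
qed (auto simp: partition_graph_def finite_partitions unit_transfer_def symmetric_def sym_def)

text \<open>The distance is the cost \<open>\<mu>\<close> of a cheapest walk when every arc costs 1, i.e. the length of a
  shortest walk. Its values are extended reals, \<open>\<infinity>\<close> standing for unreachable vertices.\<close>

definition graph_dist :: "'a pair_pre_digraph \<Rightarrow> 'a \<Rightarrow> 'a \<Rightarrow> ereal" where
  "graph_dist G u v = wf_digraph.\<mu> (with_proj G) (\<lambda>_. 1) u v"

text \<open>\<open>Min\<close> is unspecified unless \<open>S\<close> is finite and nonempty.\<close>

definition set_dist :: "'a pair_pre_digraph \<Rightarrow> 'a set \<Rightarrow> 'a \<Rightarrow> ereal" where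
  "set_dist G S u = (MIN s\<in>S. graph_dist G u s)"

definition shell :: "'a pair_pre_digraph \<Rightarrow> 'a set \<Rightarrow> nat \<Rightarrow> 'a set" where
  "shell G S r = {u \<in> pverts G. set_dist G S u = ereal (real r)}"

end

theory Submission
  imports Defs
begin

text \<open>
  The argument is the one for breadth-first search layers in any finite connected undirected graph.
  Prolonging a shortest walk by an edge shows that the distance from a vertex to \<open>S\<close> changes by at
  most 1 along an edge (\<open>set_dist_le_Suc_of_arc\<close>, used in both directions of the edge). Distances
  to \<open>S\<close> are natural numbers as soon as the vertices can reach \<open>S\<close> (\<open>set_dist_eq_nat\<close>), and two
  naturals that differ by at most 1 are equal or consecutive (\<open>shells_of_arc\<close>).

  What is special to partitions is the connectedness that rules out infinite distances. A partition
  with at least two parts can hand a unit from its last part to its first; the largest part then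
  grows, so repeating this must end in the one-part partition \<open>[n]\<close>
  (\<open>reachable_single_part\<close>). As edges are symmetric, all vertices reach each other through \<open>[n]\<close>.
\<close>

lemma (in pair_fin_digraph) graph_dist_eq_nat:
  assumes "u \<rightarrow>\<^sup>*\<^bsub>with_proj G\<^esub> v"
  shows "\<exists>k::nat. graph_dist G u v = ereal (real k)"
proof -
  obtain w where "\<mu> (\<lambda>_. 1) u v = awalk_cost (\<lambda>_. 1) w"
    using min_cost_awalk[OF assms, of "\<lambda>_. 1"] by auto
  then have "graph_dist G u v = ereal (real (length w))"
    by (simp add: graph_dist_def awalk_cost_def sum_list_triv)
  then show ?thesis by blast
qed

text \<open>A shortest walk from the head of an arc becomes a walk from its tail when the arc is put in
  front. If there is no walk from the head, the bound is \<open>\<infinity>\<close>.\<close>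

lemma (in pair_fin_digraph) graph_dist_le_Suc_of_arc:
  assumes arc: "(u, v) \<in> parcs G"
  shows "graph_dist G u s \<le> graph_dist G v s + 1"
proof (cases "v \<rightarrow>\<^sup>*\<^bsub>with_proj G\<^esub> s")
  case True
  then obtain w where w: "awalk v w s" "\<mu> (\<lambda>_. 1) v s = awalk_cost (\<lambda>_. 1) w"
    using min_cost_awalk[OF True, of "\<lambda>_. 1"] by (auto simp: apath_def)
  have "awalk u ((u, v) # w) s"
    using arc w(1) by (auto simp: awalk_Cons_iff)
  from min_cost_le_walk_cost[OF this, of "\<lambda>_. 1"] show ?thesis
    using w(2) by (simp add: graph_dist_def add.commute)
next
  case False
  then show ?thesis
    by (simp add: graph_dist_def shortest_path_inf)
qed

lemma (in pair_fin_digraph) set_dist_eq_nat: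
  assumes "finite S" "S \<noteq> {}" and reach: "\<And>s. s \<in> S \<Longrightarrow> u \<rightarrow>\<^sup>*\<^bsub>with_proj G\<^esub> s"
  shows "\<exists>k::nat. set_dist G S u = ereal (real k)"
proof -
  have "set_dist G S u \<in> graph_dist G u ` S"
    unfolding set_dist_def using assms(1,2) by (intro Min_in) auto
  then show ?thesis
    using graph_dist_eq_nat[OF reach] by auto
qed

lemma (in pair_fin_digraph) set_dist_le_Suc_of_arc:
  assumes "finite S" "S \<noteq> {}" and arc: "(u, v) \<in> parcs G"
  shows "set_dist G S u \<le> set_dist G S v + 1"
proof -
  have "set_dist G S v \<in> graph_dist G v ` S"
    unfolding set_dist_def using assms(1,2) by (intro Min_in) auto
  then obtain s where s: "s \<in> S" "set_dist G S v = graph_dist G v s"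
    by auto
  have "set_dist G S u \<le> graph_dist G u s"
    unfolding set_dist_def using \<open>finite S\<close> s(1) by (intro Min_le) auto
  also have "\<dots> \<le> set_dist G S v + 1"
    using graph_dist_le_Suc_of_arc[OF arc] s(2) by simp
  finally show ?thesis .
qed

lemma (in pair_pseudo_graph) shells_of_arc:
  assumes S: "finite S" "S \<noteq> {}" and arc: "(u, v) \<in> parcs G"
    and reach: "\<And>s. s \<in> S \<Longrightarrow> u \<rightarrow>\<^sup>*\<^bsub>with_proj G\<^esub> s" "\<And>s. s \<in> S \<Longrightarrow> v \<rightarrow>\<^sup>*\<^bsub>with_proj G\<^esub> s"
  shows "\<exists>r. (u \<in> shell G S r \<and> v \<in> shell G S r) \<or>
             (u \<in> shell G S r \<and> v \<in> shell G S (r + 1)) \<or>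
             (v \<in> shell G S r \<and> u \<in> shell G S (r + 1))"
proof -
  obtain k l :: nat where k: "set_dist G S u = ereal (real k)" and l: "set_dist G S v = ereal (real l)"
    using set_dist_eq_nat[OF S] reach by metis
  have shells: "u \<in> shell G S k" "v \<in> shell G S l"
    using k l arc by (auto simp: shell_def dest: wellformed)
  have "(v, u) \<in> parcs G"
    using arc by (simp add: arcs_symmetric)
  then have "ereal (real k) \<le> ereal (real l) + 1" "ereal (real l) \<le> ereal (real k) + 1"
    using set_dist_le_Suc_of_arc[OF S] arc k l by metis+
  then have "k = l \<or> l = k + 1 \<or> k = l + 1"
    by auto
  then show ?thesis
    using shells by blast
qed

text \<open>The first part of a partition is its largest, so the enlarged first part exceeds every old
  part: it must occur in the new partition, which is therefore a different one.\<close>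

lemma ex_unit_transfer_larger_part:
  assumes p: "p \<in> partitions n" and len: "length p \<ge> 2"
  obtains q where "q \<in> partitions n" "unit_transfer p q" "p ! 0 < q ! 0"
proof -
  define j where "j = length p - 1"
  define p' where "p' = p[0 := p ! 0 + 1, j := p ! j - 1]"
  define q where "q = rev (sort (removeAll 0 p'))"
  have j: "j < length p" "0 \<noteq> j" "0 < length p"
    using len by (auto simp: j_def)
  have sorted: "sorted_wrt (\<ge>) p" and nz: "0 \<notin> set p" and sum: "sum_list p = n"
    using p by (auto simp: partitions_def)
  have "p ! j \<noteq> 0"
    using nz j(1) nth_mem by metis
  then have "sum_list p' = n"
    using j sum member_le_sum_list[of "p ! j" p]
    by (simp add: p'_def sum_list_update)
  moreover have "sum_list (removeAll 0 xs) = sum_list xs" for xs :: "nat list"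
    by (induction xs) auto
  moreover have "sum_list (rev (sort xs)) = sum_list xs" for xs :: "nat list"
    by (metis mset_rev mset_sort sum_mset_sum_list)
  ultimately have "sum_list q = n"
    by (simp add: q_def)
  moreover have q_sorted: "sorted_wrt (\<ge>) q"
    by (simp add: q_def sorted_wrt_rev)
  ultimately have "q \<in> partitions n"
    by (auto simp: partitions_def q_def)
  have "p' ! 0 = p ! 0 + 1" "0 < length p'"
    using j by (auto simp: p'_def)
  then have "p ! 0 + 1 \<in> set p'"
    using nth_mem by metis
  then have mem: "p ! 0 + 1 \<in> set q"
    by (simp add: q_def)
  have "x \<le> xs ! 0" if "sorted_wrt (\<ge>) xs" "x \<in> set xs" for x and xs :: "nat list"
    using that by (cases xs) auto
  then have "p ! 0 + 1 \<le> q ! 0"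
    using q_sorted mem by blast
  moreover from this have "unit_transfer p q"
    unfolding unit_transfer_def using j q_def p'_def by auto
  ultimately show ?thesis
    using that \<open>q \<in> partitions n\<close> by simp
qed

text \<open>The induction measure works because no part of a partition of \<open>n\<close> exceeds \<open>n\<close>.\<close>

lemma reachable_single_part:
  assumes "n \<ge> 1" "p \<in> partitions n"
  shows "p \<rightarrow>\<^sup>*\<^bsub>with_proj (partition_graph n)\<^esub> [n]"
  using assms(2)
proof (induction "n - p ! 0" arbitrary: p rule: less_induct)
  case less
  interpret pair_graph "partition_graph n"
    by (rule pair_graph_partition_graph)
  have verts: "pverts (partition_graph n) = partitions n"
    by (simp add: partition_graph_def)
  show ?case
  proof (cases "length p \<ge> 2")
    case True
    then obtain q where q: "q \<in> partitions n" "unit_transfer p q" "p ! 0 < q ! 0"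
      using ex_unit_transfer_larger_part less.prems by blast
    have "q \<noteq> []"
      using q(1) assms(1) by (auto simp: partitions_def)
    then have "q ! 0 \<le> n"
      using q(1) member_le_sum_list[of "q ! 0" q] by (simp add: partitions_def)
    then have "q \<rightarrow>\<^sup>*\<^bsub>with_proj (partition_graph n)\<^esub> [n]"
      using q by (intro less.hyps) auto
    moreover have "(p, q) \<in> parcs (partition_graph n)"
      using q less.prems by (simp add: partition_graph_def)
    ultimately show ?thesis
      by (simp add: adj_reachable_trans)
  next
    case False
    then have "p = [n]"
      using less.prems assms(1) by (cases p; cases "tl p") (auto simp: partitions_def)
    then show ?thesis
      using less.prems verts by (simp add: reachable_refl)
  qed
qed

lemma partition_graph_reachable:
  assumes "n \<ge> 1" "p \<in> partitions n" "q \<in> partitions n"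
  shows "p \<rightarrow>\<^sup>*\<^bsub>with_proj (partition_graph n)\<^esub> q"
proof -
  interpret pair_graph "partition_graph n"
    by (rule pair_graph_partition_graph)
  show ?thesis
    using assms reachable_single_part symmetric_reachable' reachable_trans by blast
qed

theorem corollary3p3:
  fixes n :: nat and S :: "nat list set" and p q :: "nat list"
  assumes "n \<ge> 1"
    and "S \<subseteq> pverts (partition_graph n)" and "S \<noteq> {}"
    and "(p, q) \<in> parcs (partition_graph n)"
  shows "\<exists>r. (p \<in> shell (partition_graph n) S r \<and> q \<in> shell (partition_graph n) S r) \<or>
             (p \<in> shell (partition_graph n) S r \<and> q \<in> shell (partition_graph n) S (r + 1)) \<or>
             (q \<in> shell (partition_graph n) S r \<and> p \<in> shell (partition_graph n) S (r + 1))"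
proof -
  interpret pair_graph "partition_graph n"
    by (rule pair_graph_partition_graph)
  have S: "S \<subseteq> partitions n" and pq: "p \<in> partitions n" "q \<in> partitions n"
    using assms(2,4) by (auto simp: partition_graph_def)
  show ?thesis
  proof (rule shells_of_arc)
    show "finite S"
      using S finite_partitions finite_subset by blast
  qed (use assms(1,3,4) S pq partition_graph_reachable in auto)
qed

end
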